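(* Let $p\in(0,1)$ and let $\{U_i^N\}_{1\le i\le N,\,N\in\mathbb{N}}$ be i.i.d. geometric random variables with $\mathbb{P}\{U_i^N=k\}=p(1-p)^k$, $k=0,1,2,\dots$. Define $$(X_1^N,\dots,X_N^N)=\left(\frac{(1-p)NU_1^N}{p\sum_{i=1}^NU_i^N},\dots,\frac{(1-p)NU_N^N}{p\sum_{i=1}^NU_i^N}\right)$$ and the empirical measure $\mu_0^N=\frac1N\sum_{i=1}^N\delta_{X_i^N}$. Then, as $N\to\infty$, $$\mu_0^N\Longrightarrow\mu_0\sim\mathrm{Geom}(p),\qquad\mathbb{P}\text{-a.s.}$$
   Context: $\mathrm{Geom}(p)$ is the law on $\{0,1,2,\dots\}$ with mass function $p(1-p)^k$; $\mathbb{P}$ is the law of the array; $\Rightarrow$ denotes weak convergence of probability measures on $\mathbb{R}_+=[0,\infty)$. On the event $\{\sum_iU_i^N=0\}$ (of probability $p^N$) the vector $(X_1^N,\dots,X_N^N)$ is defined arbitrarily, as an element of $\{(x_1,\dots,x_N): x_i\ge0,\ \sum_i x_i=\frac{1-p}{p}N\}$. *)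

theory Defs
  imports "HOL-Probability.Probability"
begin

abbreviation borel_nonneg :: "real measure" where
  "borel_nonneg \<equiv> restrict_space borel {0..}"

(* Weak convergence of finite Borel measures on [0, infinity), tested against functions that
   are bounded and continuous on [0, infinity); values of f on the negative axis are irrelevant
   since the measures live on the subspace {0..}.  The lemma weak_conv_nonneg_iff_weak_conv_m
   below relates this to the library's (CDF-based) weak convergence on the whole line. *)
definition weak_conv_nonneg :: "(nat \<Rightarrow> real measure) \<Rightarrow> real measure \<Rightarrow> bool" where
  "weak_conv_nonneg \<mu> \<nu> \<longleftrightarrow>
     (\<forall>f :: real \<Rightarrow> real. continuous_on {0..} f \<and> bounded (f ` {0..}) \<longrightarrow>
        (\<lambda>n. \<integral>x. f x \<partial>\<mu> n) \<longlonglongrightarrow> (\<integral>x. f x \<partial>\<nu>))"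

(* (1/N) * (delta_(x 1) + ... + delta_(x N)); the library has no sum of measures, so the sum is
   taken setwise.  For N = 0 this is the null measure. *)
definition empirical_measure :: "nat \<Rightarrow> (nat \<Rightarrow> real) \<Rightarrow> real measure" where
  "empirical_measure N x =
     measure_of (space borel_nonneg) (sets borel_nonneg)
       (\<lambda>A. (\<Sum>i = 1..N. emeasure (return borel_nonneg (x i)) A) / of_nat N)"

definition geom_law :: "real \<Rightarrow> real measure" where
  "geom_law p = distr (measure_pmf (geometric_pmf p)) borel_nonneg real"

lemma sets_empirical_measure [simp, measurable_cong]:
  "sets (empirical_measure N x) = sets borel_nonneg"
  unfolding empirical_measure_def by (rule sets.sets_measure_of_eq)

lemma space_empirical_measure [simp]: "space (empirical_measure N x) = {0..}"
  using sets_eq_imp_space_eq[OF sets_empirical_measure] by (simp add: space_restrict_space)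

lemma emeasure_empirical_measure:
  assumes "A \<in> sets borel_nonneg"
  shows "emeasure (empirical_measure N x) A = (\<Sum>i = 1..N. indicator A (x i)) / of_nat N"
proof -
  let ?m = "\<lambda>A. (\<Sum>i = 1..N. emeasure (return borel_nonneg (x i)) A) / of_nat N :: ennreal"
  have "emeasure (empirical_measure N x) A = ?m A"
  proof (rule emeasure_measure_of[OF empirical_measure_def])
    show "sets borel_nonneg \<subseteq> Pow (space borel_nonneg)" by (rule sets.space_closed)
    show "positive (sets (empirical_measure N x)) ?m" by (simp add: positive_def)
    show "A \<in> sets (empirical_measure N x)" using assms by simp
    show "countably_additive (sets (empirical_measure N x)) ?m"
    proof (rule countably_additiveI)
      fix B :: "nat \<Rightarrow> real set"
      assume B: "range B \<subseteq> sets (empirical_measure N x)" "disjoint_family B"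
      then have B': "range B \<subseteq> sets (return borel_nonneg (x i))" for i by simp
      have "(\<Sum>k. ?m (B k)) = (\<Sum>k. \<Sum>i = 1..N. emeasure (return borel_nonneg (x i)) (B k)) / of_nat N"
        by (simp add: ennreal_suminf_divide del: emeasure_return)
      also have "\<dots> = ?m (\<Union>k. B k)"
        by (subst suminf_sum) (auto intro!: summableI
              simp del: emeasure_return simp: suminf_emeasure[OF B' B(2)])
      finally show "(\<Sum>k. ?m (B k)) = ?m (\<Union>k. B k)" .
    qed
  qed
  with assms show ?thesis by simp
qed

lemma prob_space_empirical_measure:
  assumes "N > 0" and "\<And>i. 1 \<le> i \<Longrightarrow> i \<le> N \<Longrightarrow> x i \<ge> 0"
  shows "prob_space (empirical_measure N x)"
proof
  have "{0..} \<in> sets borel_nonneg" by (simp add: sets_restrict_space_iff)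
  then have "emeasure (empirical_measure N x) {0..} = (\<Sum>i = 1..N. indicator {0..} (x i)) / of_nat N"
    by (rule emeasure_empirical_measure)
  also have "(\<Sum>i = 1..N. indicator {0..} (x i)) = (\<Sum>i = 1..N. 1 :: ennreal)"
    using assms by (intro sum.cong) auto
  also have "\<dots> / of_nat N = 1"
    using assms(1) by (simp add: ennreal_divide_self of_nat_less_top)
  finally show "emeasure (empirical_measure N x) (space (empirical_measure N x)) = 1" by simp
qed

lemma measurable_real_borel_nonneg: "real \<in> measurable (measure_pmf q) borel_nonneg"
  by (rule measurable_restrict_space2) auto

lemma prob_space_geom_law: "prob_space (geom_law p)"
  unfolding geom_law_def by (rule measure_pmf.prob_space_distr[OF measurable_real_borel_nonneg])

lemma sets_geom_law [simp]: "sets (geom_law p) = sets borel_nonneg"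
  by (simp add: geom_law_def)

lemma emeasure_geom_law_singleton:
  assumes "0 < p" "p < 1"
  shows "emeasure (geom_law p) {real k} = ennreal (p * (1 - p) ^ k)"
proof -
  have "{real k} \<in> sets borel_nonneg" by (simp add: sets_restrict_space_iff)
  then have "emeasure (geom_law p) {real k} = emeasure (measure_pmf (geometric_pmf p)) {k}"
    unfolding geom_law_def
    by (subst emeasure_distr[OF measurable_real_borel_nonneg]) (auto intro!: arg_cong2[where f = emeasure])
  then show ?thesis using assms by (simp add: emeasure_pmf_single mult.commute)
qed

lemma weak_conv_nonneg_iff_weak_conv_m:
  assumes \<mu>: "\<And>n. prob_space (\<mu> n)" "\<And>n. sets (\<mu> n) = sets borel_nonneg"
    and \<nu>: "prob_space \<nu>" "sets \<nu> = sets borel_nonneg"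
  shows "weak_conv_nonneg \<mu> \<nu> \<longleftrightarrow>
    weak_conv_m (\<lambda>n. distr (\<mu> n) borel (\<lambda>x. x)) (distr \<nu> borel (\<lambda>x. x))"
proof
  have meas: "(\<lambda>x. x) \<in> borel_measurable \<kappa>" if "sets \<kappa> = sets borel_nonneg" for \<kappa> :: "real measure"
    unfolding measurable_cong_sets[OF that refl] by (rule measurable_restrict_space1) simp
  have real: "real_distribution (distr \<kappa> borel (\<lambda>x. x))"
    if "prob_space \<kappa>" "sets \<kappa> = sets borel_nonneg" for \<kappa> :: "real measure"
    using prob_space.real_distribution_distr[OF that(1) meas[OF that(2)]] .
  have int: "(\<integral>x. g x \<partial>distr \<kappa> borel (\<lambda>x. x)) = (\<integral>x. f x \<partial>\<kappa>)"
    if "sets \<kappa> = sets borel_nonneg" "continuous_on UNIV g" "\<And>x. x \<ge> 0 \<Longrightarrow> g x = f x"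
    for \<kappa> :: "real measure" and f g :: "real \<Rightarrow> real"
  proof -
    have "space \<kappa> = {0..}"
      using sets_eq_imp_space_eq[OF that(1)] by (simp add: space_restrict_space)
    then show ?thesis using that(2,3)
      by (subst integral_distr[OF meas[OF that(1)]])
        (auto intro!: borel_measurable_continuous_onI Bochner_Integration.integral_cong)
  qed
  show "weak_conv_m (\<lambda>n. distr (\<mu> n) borel (\<lambda>x. x)) (distr \<nu> borel (\<lambda>x. x))"
    if conv: "weak_conv_nonneg \<mu> \<nu>"
  proof (rule integral_bdd_continuous_conv_imp_weak_conv)
    fix f :: "real \<Rightarrow> real" assume f: "\<And>x. isCont f x" "\<And>x. \<bar>f x\<bar> \<le> 1"
    have c: "continuous_on UNIV f" by (simp add: continuous_at_imp_continuous_on f)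
    have "continuous_on {0..} f" "bounded (f ` {0..})"
      using c f(2) by (auto intro: continuous_on_subset simp: bounded_iff)
    with conv have "(\<lambda>n. \<integral>x. f x \<partial>\<mu> n) \<longlonglongrightarrow> (\<integral>x. f x \<partial>\<nu>)"
      unfolding weak_conv_nonneg_def by blast
    then show "(\<lambda>n. \<integral>x. f x \<partial>distr (\<mu> n) borel (\<lambda>x. x)) \<longlonglongrightarrow> (\<integral>x. f x \<partial>distr \<nu> borel (\<lambda>x. x))"
      using int[OF \<mu>(2) c] int[OF \<nu>(2) c] by simp
  qed (use real \<mu> \<nu> in auto)
  show "weak_conv_nonneg \<mu> \<nu>"
    if conv: "weak_conv_m (\<lambda>n. distr (\<mu> n) borel (\<lambda>x. x)) (distr \<nu> borel (\<lambda>x. x))"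
    unfolding weak_conv_nonneg_def
  proof (intro allI impI, elim conjE)
    fix f :: "real \<Rightarrow> real" assume f: "continuous_on {0..} f" "bounded (f ` {0..})"
    define g where "g x = f (max 0 x)" for x
    have c: "continuous_on UNIV g"
      unfolding g_def by (rule continuous_on_compose2[OF f(1)]) (auto intro!: continuous_intros)
    from f(2) obtain B where B: "\<And>x. x \<ge> 0 \<Longrightarrow> norm (f x) \<le> B"
      by (auto simp: bounded_iff)
    have "(\<lambda>n. \<integral>x. g x \<partial>distr (\<mu> n) borel (\<lambda>x. x)) \<longlonglongrightarrow> (\<integral>x. g x \<partial>distr \<nu> borel (\<lambda>x. x))"
      by (rule weak_conv_imp_integral_bdd_continuous_conv[where B = B])
        (use real \<mu> \<nu> conv c B in \<open>auto simp: continuous_on_eq_continuous_at g_def\<close>)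
    moreover have "g x = f x" if "x \<ge> 0" for x using that by (simp add: g_def)
    ultimately show "(\<lambda>n. \<integral>x. f x \<partial>\<mu> n) \<longlonglongrightarrow> (\<integral>x. f x \<partial>\<nu>)"
      using int[OF \<mu>(2) c] int[OF \<nu>(2) c] by simp
  qed
qed

end

theory Submission
  imports Defs
begin

text \<open>
  Write \<open>S\<^sub>N\<close> for the sum of row \<open>N\<close> and \<open>m = (1 - p) / p\<close> for the mean of the geometric law. As soon
  as \<open>S\<^sub>N > 0\<close>, the entries of the row are \<open>X N i = s\<^sub>N * U N i\<close> with the common factor
  \<open>s\<^sub>N = m / (S\<^sub>N / N)\<close>. Hence the theorem follows from two almost sure facts: \<open>S\<^sub>N / N\<close> tends to \<open>m\<close>,
  so that \<open>s\<^sub>N\<close> tends to 1 and the rows with \<open>S\<^sub>N = 0\<close> eventually stop occurring; and, for every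
  \<open>k\<close>, the proportion of indices \<open>i\<close> with \<open>U N i = k\<close> tends to \<open>p * (1 - p) ^ k\<close>.

  Both facts are strong laws for row averages. Each row consists of new variables, so the row sums
  are not the partial sums of one sequence and the classical strong law does not apply; the
  deviation probabilities must be summable over \<open>N\<close> so that the Borel-Cantelli lemma can be used.
  Moment generating functions that exist near 0 give Chernoff bounds which are geometric in \<open>N\<close>
  (lemma \<open>strong_law_rows\<close>). This covers the indicators, and it covers the geometric variables
  because their generating function \<open>p / (1 - (1 - p) * exp t)\<close> is finite for \<open>t < - ln (1 - p)\<close>.

  The rest is deterministic (lemma \<open>weak_conv_nonneg_rescaled_empirical_measure\<close>). Integrating a
  test function \<open>f\<close> against the empirical measure amounts to integrating \<open>k \<mapsto> f (s\<^sub>N * k)\<close>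
  against the empirical distribution of \<open>U N 1, \<dots>, U N N\<close> on the naturals. These
  functions converge pointwise and boundedly to \<open>k \<mapsto> f k\<close>, and pointwise convergence of
  probability mass functions to a probability mass function rules out an escape of mass to infinity
  (lemma \<open>tendsto_expectation_pmf\<close>).
\<close>

section \<open>A strong law for the rows of a triangular array\<close>

text \<open>
  By Markov's inequality for \<open>exp (t * _)\<close>, the probability that the average of row \<open>N\<close> is at least
  \<open>b\<close> is at most \<open>(\<phi> t * exp (- t * b)) ^ N\<close>. The base equals 1 at \<open>t = 0\<close> and has derivative
  \<open>c - b < 0\<close> there, so it is below 1 for some small positive \<open>t\<close>; these bounds then form a convergent
  geometric series.
\<close>
lemma (in prob_space) AE_eventually_row_mean_less:
  fixes Y :: "nat \<Rightarrow> nat \<Rightarrow> 'a \<Rightarrow> real"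
  assumes indep: "\<And>N. indep_vars (\<lambda>_. borel) (Y N) {1..N}"
    and "\<delta> > 0"
    and integrable: "\<And>N i t. i \<in> {1..N} \<Longrightarrow> \<bar>t\<bar> < \<delta> \<Longrightarrow> integrable M (\<lambda>\<omega>. exp (t * Y N i \<omega>))"
    and mgf: "\<And>N i t. i \<in> {1..N} \<Longrightarrow> \<bar>t\<bar> < \<delta> \<Longrightarrow> expectation (\<lambda>\<omega>. exp (t * Y N i \<omega>)) = \<phi> t"
    and deriv: "(\<phi> has_real_derivative c) (at 0)"
    and "c < b"
  shows "AE \<omega> in M. \<forall>\<^sub>F N in sequentially. (\<Sum>i = 1..N. Y N i \<omega>) / real N < b"
proof -
  have "\<phi> 0 = 1"
    using mgf[of 1 1 0] \<open>\<delta> > 0\<close> by (simp add: prob_space)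
  then have "((\<lambda>t. \<phi> t * exp (- t * b)) has_real_derivative c - b) (at 0)"
    by (auto intro!: derivative_eq_intros deriv)
  from DERIV_neg_dec_right[OF this] \<open>c < b\<close> obtain d where d: "d > 0"
    "\<And>h. 0 < h \<Longrightarrow> h < d \<Longrightarrow> \<phi> h * exp (- h * b) < 1"
    by (auto simp: \<open>\<phi> 0 = 1\<close>)
  define t where "t = min d \<delta> / 2"
  define \<rho> where "\<rho> = \<phi> t * exp (- t * b)"
  have t: "0 < t" "\<bar>t\<bar> < \<delta>" using d(1) \<open>\<delta> > 0\<close> by (auto simp: t_def)
  have "\<rho> < 1" unfolding \<rho>_def using d(2)[of t] d(1) t \<open>\<delta> > 0\<close> by (auto simp: t_def)
  have "\<phi> t \<ge> 0"
    using mgf[of 1 1 t, symmetric] t by simp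
  then have "\<rho> \<ge> 0" by (simp add: \<rho>_def)
  have meas: "random_variable borel (Y N i)" if "i \<in> {1..N}" for N i
    using indep[of N] that by (auto simp: indep_vars_def)
  define A where "A N = {\<omega> \<in> space M. real N * b \<le> (\<Sum>i = 1..N. Y N i \<omega>)}" for N
  have [measurable]: "A N \<in> events" for N
    unfolding A_def using meas by measurable
  have bound: "prob (A N) \<le> \<rho> ^ N" for N
  proof -
    have ind: "indep_vars (\<lambda>_. borel) (\<lambda>i \<omega>. exp (t * Y N i \<omega>)) {1..N}"
      by (rule indep_vars_compose2[OF indep]) simp
    have prod: "exp (t * (\<Sum>i = 1..N. Y N i \<omega>)) = (\<Prod>i = 1..N. exp (t * Y N i \<omega>))" for \<omega>
      by (simp add: sum_distrib_left exp_sum)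
    have int: "integrable M (\<lambda>\<omega>. exp (t * (\<Sum>i = 1..N. Y N i \<omega>)))"
      unfolding prod using integrable t by (intro indep_vars_integrable ind) auto
    have "expectation (\<lambda>\<omega>. exp (t * (\<Sum>i = 1..N. Y N i \<omega>))) = \<phi> t ^ N"
      unfolding prod using integrable mgf t by (subst indep_vars_lebesgue_integral[OF _ ind]) auto
    moreover have "prob (A N) \<le> exp (- t * (real N * b)) *
        (LINT \<omega>:space M|M. exp (t * (\<Sum>i = 1..N. Y N i \<omega>)))"
      unfolding A_def using t integrable_mult_indicator[OF sets.top int]
      by (intro Chernoff_ineq_ge) (auto simp: set_integrable_def)
    ultimately show ?thesis
      using int by (simp add: set_integral_space \<rho>_def power_mult_distrib exp_of_nat_mult[symmetric] mult_ac)
  qed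
  have "AE \<omega> in M. \<forall>\<^sub>F N in sequentially. \<omega> \<in> space M - A N"
  proof (rule borel_cantelli_AE1)
    show "summable (\<lambda>N. prob (A N))"
      using \<open>\<rho> \<ge> 0\<close> \<open>\<rho> < 1\<close> bound
      by (intro summable_comparison_test'[OF summable_geometric[of \<rho>]]) auto
  qed (auto simp: less_top[symmetric])
  then show ?thesis
  proof eventually_elim
    case (elim \<omega>)
    with eventually_gt_at_top[of 0] show ?case
      by eventually_elim (auto simp: A_def field_simps)
  qed
qed

text \<open>
  The lower deviations of \<open>Y\<close> are the upper deviations of \<open>- Y\<close>, whose moment generating function is
  \<open>t \<mapsto> \<phi> (- t)\<close>. As \<open>\<phi>\<close> is the moment generating function of each entry, \<open>c\<close>, its derivative
  at 0, is their common mean.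
\<close>
lemma (in prob_space) strong_law_rows:
  fixes Y :: "nat \<Rightarrow> nat \<Rightarrow> 'a \<Rightarrow> real"
  assumes indep: "\<And>N. indep_vars (\<lambda>_. borel) (Y N) {1..N}"
    and "\<delta> > 0"
    and integrable: "\<And>N i t. i \<in> {1..N} \<Longrightarrow> \<bar>t\<bar> < \<delta> \<Longrightarrow> integrable M (\<lambda>\<omega>. exp (t * Y N i \<omega>))"
    and mgf: "\<And>N i t. i \<in> {1..N} \<Longrightarrow> \<bar>t\<bar> < \<delta> \<Longrightarrow> expectation (\<lambda>\<omega>. exp (t * Y N i \<omega>)) = \<phi> t"
    and deriv: "(\<phi> has_real_derivative c) (at 0)"
  shows "AE \<omega> in M. (\<lambda>N. (\<Sum>i = 1..N. Y N i \<omega>) / real N) \<longlonglongrightarrow> c"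
proof -
  \<comment> \<open>Only countably many margins may be used, so that the exceptional null sets can be united.\<close>
  have up: "AE \<omega> in M. \<forall>\<^sub>F N in sequentially. (\<Sum>i = 1..N. Y N i \<omega>) / real N < c + 1 / real (Suc m)"
    for m
    by (rule AE_eventually_row_mean_less[OF assms(1-5)]) auto
  have low: "AE \<omega> in M. \<forall>\<^sub>F N in sequentially.
      (\<Sum>i = 1..N. - Y N i \<omega>) / real N < - c + 1 / real (Suc m)" for m
  proof (rule AE_eventually_row_mean_less[where \<delta> = \<delta> and \<phi> = "\<lambda>t. \<phi> (- t)" and c = "- c"])
    show "indep_vars (\<lambda>_. borel) (\<lambda>i \<omega>. - Y N i \<omega>) {1..N}" for N
      by (rule indep_vars_compose2[OF indep]) simp
    show "integrable M (\<lambda>\<omega>. exp (t * - Y N i \<omega>))" if "i \<in> {1..N}" "\<bar>t\<bar> < \<delta>" for N i t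
      using integrable[of i N "- t"] that by simp
    show "expectation (\<lambda>\<omega>. exp (t * - Y N i \<omega>)) = \<phi> (- t)" if "i \<in> {1..N}" "\<bar>t\<bar> < \<delta>" for N i t
      using mgf[of i N "- t"] that by simp
    show "((\<lambda>t. \<phi> (- t)) has_real_derivative - c) (at 0)"
      using deriv DERIV_mirror[where f = \<phi> and x = 0 and y = c] by simp
  qed (use \<open>\<delta> > 0\<close> in auto)
  have "AE \<omega> in M. \<forall>m. (\<forall>\<^sub>F N in sequentially. (\<Sum>i = 1..N. Y N i \<omega>) / real N < c + 1 / real (Suc m)) \<and>
      (\<forall>\<^sub>F N in sequentially. (\<Sum>i = 1..N. - Y N i \<omega>) / real N < - c + 1 / real (Suc m))"
    using up low by (simp add: AE_all_countable)
  then show ?thesis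
  proof eventually_elim
    case (elim \<omega>)
    show ?case
    proof (rule tendstoI)
      fix e :: real assume "e > 0"
      then obtain m where m: "1 / real (Suc m) < e" using nat_approx_posE by blast
      from elim have "\<forall>\<^sub>F N in sequentially. (\<Sum>i = 1..N. Y N i \<omega>) / real N < c + 1 / real (Suc m)"
        "\<forall>\<^sub>F N in sequentially. (\<Sum>i = 1..N. - Y N i \<omega>) / real N < - c + 1 / real (Suc m)" by auto
      then show "\<forall>\<^sub>F N in sequentially. dist ((\<Sum>i = 1..N. Y N i \<omega>) / real N) c < e"
        by eventually_elim (use m in \<open>auto simp: sum_negf dist_real_def\<close>)
    qed
  qed
qed

section \<open>Convergence of probability mass functions on the naturals\<close>

text \<open>
  The right-hand side is \<open>B\<close> times the mass of the tail beyond \<open>K\<close>. It is written in terms of the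
  masses of \<open>0, \<dots>, K\<close> because these finitely many values can be passed to the limit when
  \<open>r\<close> varies.
\<close>
lemma abs_expectation_minus_partial_sum_le:
  fixes r :: "nat pmf" and g :: "nat \<Rightarrow> real"
  assumes "\<And>k. \<bar>g k\<bar> \<le> B"
  shows "\<bar>measure_pmf.expectation r g - (\<Sum>k\<le>K. g k * pmf r k)\<bar> \<le> B * (1 - (\<Sum>k\<le>K. pmf r k))"
proof -
  have int: "integrable r (\<lambda>k. h k * g k)" if "\<And>k. \<bar>h k\<bar> \<le> 1" for h :: "nat \<Rightarrow> real"
    using assms mult_mono[OF that assms, of _ ]
    by (intro measure_pmf.integrable_const_bound[where B = B]) (auto simp: abs_mult)
  have int_g: "integrable r g" using int[of "\<lambda>_. 1"] by simp
  have sum: "(\<Sum>k\<le>K. h k * pmf r k) = measure_pmf.expectation r (\<lambda>k. indicator {..K} k * h k)"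
    for h :: "nat \<Rightarrow> real"
    by (subst integral_measure_pmf[of "{..K}"]) (auto simp: indicator_def mult_ac)
  have "measure_pmf.expectation r g - (\<Sum>k\<le>K. g k * pmf r k) =
      measure_pmf.expectation r (\<lambda>k. indicator {K<..} k * g k)"
  proof -
    have "measure_pmf.expectation r (\<lambda>k. indicator {K<..} k * g k) =
        measure_pmf.expectation r (\<lambda>k. g k - indicator {..K} k * g k)"
      by (intro Bochner_Integration.integral_cong) (auto split: split_indicator)
    also have "\<dots> = measure_pmf.expectation r g - measure_pmf.expectation r (\<lambda>k. indicator {..K} k * g k)"
      by (intro Bochner_Integration.integral_diff int_g int) (auto simp: indicator_def)
    finally show ?thesis unfolding sum by simp
  qed
  also have "\<bar>\<dots>\<bar> \<le> measure_pmf.expectation r (\<lambda>k. B * indicator {K<..} k)"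
  proof (rule integral_abs_bound[THEN order_trans], rule integral_mono)
    show "integrable r (\<lambda>k. \<bar>indicator {K<..} k * g k\<bar>)"
      by (intro integrable_abs int) (auto simp: indicator_def)
    show "integrable r (\<lambda>k. B * indicator {K<..} k)"
      by (intro integrable_mult_right integrable_real_indicator) (auto simp: less_top[symmetric])
  qed (auto simp: assms split: split_indicator)
  also have "\<dots> = B * (1 - (\<Sum>k\<le>K. pmf r k))"
  proof -
    have "measure r {K<..} = 1 - measure r {..K}"
      using measure_pmf.prob_compl[of "{..K}" r] by (simp add: Compl_eq_Diff_UNIV[symmetric])
    then show ?thesis by (simp add: measure_measure_pmf_finite)
  qed
  finally show ?thesis .
qed

text \<open>
  Choose \<open>K\<close> such that \<open>q\<close> has little mass beyond \<open>K\<close>. The finitely many values up to \<open>K\<close> converge;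
  since the total mass is 1 for \<open>r N\<close> and for \<open>q\<close>, the mass of \<open>r N\<close> beyond \<open>K\<close> converges to the
  small tail mass of \<open>q\<close>.
\<close>
lemma tendsto_expectation_pmf:
  fixes q :: "nat pmf" and r :: "nat \<Rightarrow> nat pmf" and h :: "nat \<Rightarrow> nat \<Rightarrow> real"
  assumes r: "\<And>k. (\<lambda>N. pmf (r N) k) \<longlonglongrightarrow> pmf q k"
    and h: "\<And>k. (\<lambda>N. h N k) \<longlonglongrightarrow> g k"
    and bound: "\<And>N k. \<bar>h N k\<bar> \<le> B"
  shows "(\<lambda>N. measure_pmf.expectation (r N) (h N)) \<longlonglongrightarrow> measure_pmf.expectation q g"
proof (rule tendstoI)
  fix e :: real assume "e > 0"
  have g: "\<bar>g k\<bar> \<le> B" for k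
    using tendsto_rabs[OF h] by (rule tendsto_upperbound) (use bound in auto)
  have "B \<ge> 0" using g[of 0] by linarith
  \<comment> \<open>The factor 2 accounts for one tail from \<open>q\<close> and one from \<open>r N\<close>.\<close>
  have "(\<lambda>K. 2 * (B * (1 - (\<Sum>k\<le>K. pmf q k)))) \<longlonglongrightarrow> 2 * (B * (1 - 1))"
  proof (intro tendsto_intros)
    have "(\<lambda>K. \<Sum>k<K. pmf q k) \<longlonglongrightarrow> 1"
      using sums_integral_count_space_nat[OF integrable_pmf[where M = q]] integral_pmf[where M = q and X = UNIV]
      by (simp add: sums_def)
    then show "(\<lambda>K. \<Sum>k\<le>K. pmf q k) \<longlonglongrightarrow> 1"
      by (auto dest: LIMSEQ_Suc simp: lessThan_Suc_atMost)
  qed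
  then have "\<forall>\<^sub>F K in sequentially. 2 * (B * (1 - (\<Sum>k\<le>K. pmf q k))) < e"
    using \<open>e > 0\<close> by (intro order_tendstoD) auto
  then obtain K where K: "2 * (B * (1 - (\<Sum>k\<le>K. pmf q k))) < e"
    by (auto simp: eventually_sequentially)
  define E where "E N = \<bar>(\<Sum>k\<le>K. h N k * pmf (r N) k) - (\<Sum>k\<le>K. g k * pmf q k)\<bar> +
      B * (1 - (\<Sum>k\<le>K. pmf (r N) k)) + B * (1 - (\<Sum>k\<le>K. pmf q k))" for N
  have "E \<longlonglongrightarrow> \<bar>(\<Sum>k\<le>K. g k * pmf q k) - (\<Sum>k\<le>K. g k * pmf q k)\<bar> +
      B * (1 - (\<Sum>k\<le>K. pmf q k)) + B * (1 - (\<Sum>k\<le>K. pmf q k))"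
    unfolding E_def by (intro tendsto_intros r h)
  then have "\<forall>\<^sub>F N in sequentially. E N < e"
    using K by (intro order_tendstoD) auto
  then show "\<forall>\<^sub>F N in sequentially.
      dist (measure_pmf.expectation (r N) (h N)) (measure_pmf.expectation q g) < e"
  proof eventually_elim
    case (elim N)
    show ?case
      using elim abs_expectation_minus_partial_sum_le[where r = "r N" and g = "h N" and K = K, OF bound]
        abs_expectation_minus_partial_sum_le[where r = q and g = g and K = K, OF g]
      unfolding E_def dist_real_def by linarith
  qed
qed

section \<open>Integrals against the empirical measure\<close>

text \<open>
  Every function on the naturals is measurable for a probability mass function, but as a map into the
  subspace \<open>borel_nonneg\<close> it must be nonnegative everywhere; this is why \<open>x\<close> is replaced by 0 outside
  the support of the uniform distribution.
\<close>
lemma empirical_measure_eq_distr: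
  assumes "N > 0" and "\<And>i. i \<in> {1..N} \<Longrightarrow> x i \<ge> 0"
  shows "empirical_measure N x =
    distr (measure_pmf (pmf_of_set {1..N})) borel_nonneg (\<lambda>i. if i \<in> {1..N} then x i else 0)"
proof -
  let ?y = "\<lambda>i. if i \<in> {1..N} then x i else 0"
  have meas: "?y \<in> measurable (measure_pmf (pmf_of_set {1..N})) borel_nonneg"
    using assms(2) by (intro measurable_restrict_space2) auto
  show ?thesis
  proof (rule measure_eqI)
    fix A assume "A \<in> sets (empirical_measure N x)"
    then have A: "A \<in> sets borel_nonneg" by simp
    have "(\<Sum>i = 1..N. indicator A (x i) :: ennreal) = (\<Sum>i = 1..N. indicator (?y -` A) i)"
      by (intro sum.cong) (auto simp: indicator_def)
    also have "\<dots> = of_nat (card ({1..N} \<inter> ?y -` A))"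
      by (auto simp: indicator_def sum.If_cases intro!: arg_cong[where f = card])
    finally have "(\<Sum>i = 1..N. indicator A (x i) :: ennreal) = of_nat (card ({1..N} \<inter> ?y -` A))" .
    then show "emeasure (empirical_measure N x) A =
        emeasure (distr (measure_pmf (pmf_of_set {1..N})) borel_nonneg ?y) A"
      using A meas assms(1)
      by (simp add: emeasure_empirical_measure emeasure_distr emeasure_pmf_of_set
        ennreal_of_nat_eq_real_of_nat divide_ennreal)
  qed simp
qed

lemma integral_empirical_measure:
  fixes f :: "real \<Rightarrow> real"
  assumes "N > 0" and "\<And>i. i \<in> {1..N} \<Longrightarrow> x i \<ge> 0" and "f \<in> borel_measurable borel_nonneg"
  shows "(\<integral>y. f y \<partial>empirical_measure N x) = measure_pmf.expectation (pmf_of_set {1..N}) (\<lambda>i. f (x i))"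
    (is "_ = ?rhs")
proof -
  have meas: "(\<lambda>i. if i \<in> {1..N} then x i else 0) \<in> measurable (measure_pmf (pmf_of_set {1..N})) borel_nonneg"
    using assms(2) by (intro measurable_restrict_space2) auto
  have "(\<integral>y. f y \<partial>empirical_measure N x) = measure_pmf.expectation (pmf_of_set {1..N})
      (\<lambda>i. f (if i \<in> {1..N} then x i else 0))"
    using integral_distr[OF meas assms(3)] empirical_measure_eq_distr[of N x] assms(1,2) by simp
  also have "\<dots> = ?rhs"
    using assms(1) by (intro integral_cong_AE) (auto simp: AE_measure_pmf_iff)
  finally show ?thesis .
qed

text \<open>
  The rows \<open>u N\<close> have empirical distributions that converge pointwise to \<open>q\<close>. Multiplication by a
  factor \<open>s N\<close> that tends to 1 does not change the limit: the rescaling is moved from the measure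
  into the test function, where continuity absorbs it.
\<close>
lemma weak_conv_nonneg_rescaled_empirical_measure:
  fixes u :: "nat \<Rightarrow> nat \<Rightarrow> nat" and x :: "nat \<Rightarrow> nat \<Rightarrow> real" and q :: "nat pmf"
  assumes freq: "\<And>k. (\<lambda>N. (\<Sum>i = 1..N. indicator {k} (u N i)) / real N) \<longlonglongrightarrow> pmf q k"
    and s: "s \<longlonglongrightarrow> 1"
    and x: "\<forall>\<^sub>F N in sequentially. \<forall>i\<in>{1..N}. x N i = s N * real (u N i)"
  shows "weak_conv_nonneg (\<lambda>N. empirical_measure N (x N)) (distr (measure_pmf q) borel_nonneg real)"
  unfolding weak_conv_nonneg_def
proof (intro allI impI, elim conjE)
  fix f :: "real \<Rightarrow> real" assume f: "continuous_on {0..} f" "bounded (f ` {0..})"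
  from f(2) obtain B where B: "\<And>y. y \<ge> 0 \<Longrightarrow> \<bar>f y\<bar> \<le> B"
    by (auto simp: bounded_iff)
  have f_meas: "f \<in> borel_measurable borel_nonneg"
    by (rule borel_measurable_continuous_on_restrict[OF f(1)])
  define r where "r N = map_pmf (u N) (pmf_of_set {1..N})" for N
  \<comment> \<open>The factors \<open>s N\<close> are positive only eventually; \<open>max 0\<close> keeps the argument of \<open>f\<close> in the
    half-line, where \<open>f\<close> is bounded and continuous, for all \<open>N\<close>.\<close>
  define h where "h N k = f (max 0 (s N) * real k)" for N k
  have "(\<lambda>N. pmf (r N) k) \<longlonglongrightarrow> pmf q k" for k
  proof (rule Lim_transform_eventually[OF freq])
    show "\<forall>\<^sub>F N in sequentially. (\<Sum>i = 1..N. indicator {k} (u N i)) / real N = pmf (r N) k"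
      using eventually_gt_at_top[of 0]
    proof eventually_elim
      case (elim N)
      have "pmf (r N) k = measure_pmf.expectation (r N) (indicator {k})"
        by (simp add: measure_pmf_single)
      also have "\<dots> = measure_pmf.expectation (pmf_of_set {1..N}) (\<lambda>i. indicator {k} (u N i))"
        unfolding r_def by (rule integral_map_pmf)
      also have "\<dots> = (\<Sum>i = 1..N. indicator {k} (u N i)) / real N"
        using elim by (subst integral_pmf_of_set) auto
      finally show ?case by simp
    qed
  qed
  moreover have "(\<lambda>N. h N k) \<longlonglongrightarrow> f (real k)" for k
  proof -
    have "(\<lambda>N. max 0 (s N) * real k) \<longlonglongrightarrow> max 0 1 * real k"
      by (intro tendsto_intros s)
    then show ?thesis
      unfolding h_def by (intro continuous_on_tendsto_compose[OF f(1)]) auto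
  qed
  moreover have "\<bar>h N k\<bar> \<le> B" for N k
    unfolding h_def by (rule B) simp
  ultimately have lim: "(\<lambda>N. measure_pmf.expectation (r N) (h N)) \<longlonglongrightarrow>
      measure_pmf.expectation q (\<lambda>k. f (real k))"
    by (rule tendsto_expectation_pmf)
  have "(\<integral>y. f y \<partial>distr (measure_pmf q) borel_nonneg real) = measure_pmf.expectation q (\<lambda>k. f (real k))"
    by (rule integral_distr[OF measurable_real_borel_nonneg f_meas])
  moreover have "\<forall>\<^sub>F N in sequentially.
      measure_pmf.expectation (r N) (h N) = (\<integral>y. f y \<partial>empirical_measure N (x N))"
    using eventually_gt_at_top[of 0] x order_tendstoD(1)[OF s zero_less_one]
  proof eventually_elim
    case (elim N)
    then have "(\<integral>y. f y \<partial>empirical_measure N (x N)) = 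
        measure_pmf.expectation (pmf_of_set {1..N}) (\<lambda>i. f (x N i))"
      by (intro integral_empirical_measure f_meas) auto
    also have "\<dots> = measure_pmf.expectation (pmf_of_set {1..N}) (\<lambda>i. h N (u N i))"
      using elim by (intro integral_cong_AE) (auto simp: AE_measure_pmf_iff h_def)
    finally show ?case by (simp add: r_def)
  qed
  ultimately show "(\<lambda>N. \<integral>y. f y \<partial>empirical_measure N (x N)) \<longlonglongrightarrow>
      (\<integral>y. f y \<partial>distr (measure_pmf q) borel_nonneg real)"
    using Lim_transform_eventually[OF lim] by simp
qed

section \<open>The geometric law and the rows of the array\<close>

text \<open>
  The integrand against counting measure is a geometric series with ratio \<open>(1 - p) * exp t\<close>, and the
  bound on \<open>t\<close> says that this ratio is less than 1.
\<close>
lemma mgf_geometric_pmf: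
  assumes "0 < p" "p < 1" "t < - ln (1 - p)"
  shows "integrable (geometric_pmf p) (\<lambda>k. exp (t * real k))" (is ?int)
    and "measure_pmf.expectation (geometric_pmf p) (\<lambda>k. exp (t * real k)) = p / (1 - (1 - p) * exp t)" (is ?eq)
proof -
  let ?a = "(1 - p) * exp t"
  have "exp t < exp (- ln (1 - p))" using assms by simp
  then have a: "0 \<le> ?a" "?a < 1" using assms by (auto simp: exp_minus field_simps)
  have eq: "pmf (geometric_pmf p) k * exp (t * real k) = p * ?a ^ k" for k
    using assms by (simp add: power_mult_distrib exp_of_nat_mult[symmetric] mult_ac)
  have sums: "(\<lambda>k. p * ?a ^ k) sums (p * (1 / (1 - ?a)))"
    using a by (intro sums_mult geometric_sums) auto
  have int: "integrable (count_space UNIV) (\<lambda>k. pmf (geometric_pmf p) k * exp (t * real k))"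
    unfolding eq integrable_count_space_nat_iff using sums a assms by (auto simp: sums_iff abs_mult)
  then show ?int
    unfolding measure_pmf_eq_density by (subst integrable_density) auto
  have "measure_pmf.expectation (geometric_pmf p) (\<lambda>k. exp (t * real k)) =
      (\<integral>k. pmf (geometric_pmf p) k * exp (t * real k) \<partial>count_space UNIV)"
    unfolding measure_pmf_eq_density by (subst integral_density) auto
  also have "\<dots> = p * (1 / (1 - ?a))"
    using sums_integral_count_space_nat[OF int] sums unfolding eq by (rule sums_unique2)
  finally show ?eq by simp
qed

lemma (in prob_space) distr_eq_measure_pmf_nat:
  fixes V :: "'a \<Rightarrow> nat"
  assumes [measurable]: "V \<in> measurable M (count_space UNIV)"
    and "\<And>k. prob {\<omega> \<in> space M. V \<omega> = k} = pmf q k"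
  shows "distr M (count_space UNIV) V = measure_pmf q"
proof (rule measure_eqI_countable[of _ UNIV])
  fix k
  have "V -` {k} \<inter> space M = {\<omega> \<in> space M. V \<omega> = k}" by auto
  then show "emeasure (distr M (count_space UNIV) V) {k} = emeasure (measure_pmf q) {k}"
    using assms(2)[of k] by (simp add: emeasure_distr emeasure_eq_measure emeasure_pmf_single)
qed auto

text \<open>
  The joint independence is indexed by pairs. Grouping the index set into the singletons \<open>{(N, j)}\<close>
  and projecting each group to its only coordinate makes \<open>j\<close> the index.
\<close>
lemma (in prob_space) indep_vars_row:
  assumes "indep_vars (\<lambda>_. S) (\<lambda>(N, i). U N i) {(N, i). 1 \<le> i \<and> i \<le> N}"
  shows "indep_vars (\<lambda>_. S) (U N) {1..N}"
proof -
  have "indep_vars (\<lambda>j. PiM {(N, j)} (\<lambda>_. S)) (\<lambda>j \<omega>. \<lambda>z\<in>{(N, j)}. (case z of (N, i) \<Rightarrow> U N i) \<omega>) {1..N}"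
    by (rule indep_vars_restrict[OF assms]) (auto simp: disjoint_family_on_def)
  then have "indep_vars (\<lambda>_. S) (\<lambda>j \<omega>. (\<lambda>z\<in>{(N, j)}. (case z of (N, i) \<Rightarrow> U N i) \<omega>) (N, j)) {1..N}"
    by (rule indep_vars_compose2[where Y = "\<lambda>j f. f (N, j)"]) auto
  then show ?thesis by simp
qed

theorem theorem6p5:
  fixes M :: "'a measure" and p :: real
    and U :: "nat \<Rightarrow> nat \<Rightarrow> 'a \<Rightarrow> nat" and X :: "nat \<Rightarrow> nat \<Rightarrow> 'a \<Rightarrow> real"
  assumes "prob_space M" and "0 < p" and "p < 1"
    and "prob_space.indep_vars M (\<lambda>_. count_space UNIV) (\<lambda>(N, i). U N i)
           {(N, i). 1 \<le> i \<and> i \<le> N}"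
    and "\<And>N i k. 1 \<le> i \<Longrightarrow> i \<le> N \<Longrightarrow>
           measure M {\<omega> \<in> space M. U N i \<omega> = k} = p * (1 - p) ^ k"
    and "\<And>N i \<omega>. \<omega> \<in> space M \<Longrightarrow> 1 \<le> i \<Longrightarrow> i \<le> N \<Longrightarrow> (\<Sum>j = 1..N. U N j \<omega>) \<noteq> 0 \<Longrightarrow>
           X N i \<omega> = (1 - p) * real N * real (U N i \<omega>) / (p * real (\<Sum>j = 1..N. U N j \<omega>))"
    and "\<And>N \<omega>. \<omega> \<in> space M \<Longrightarrow> 1 \<le> N \<Longrightarrow> (\<Sum>j = 1..N. U N j \<omega>) = 0 \<Longrightarrow>
           (\<forall>i\<in>{1..N}. 0 \<le> X N i \<omega>) \<and> (\<Sum>i = 1..N. X N i \<omega>) = (1 - p) / p * real N"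
  shows "AE \<omega> in M. weak_conv_nonneg (\<lambda>N. empirical_measure N (\<lambda>i. X N i \<omega>)) (geom_law p)"
proof -
  interpret prob_space M by fact
  let ?m = "(1 - p) / p" and ?G = "geometric_pmf p"
  have indep: "indep_vars (\<lambda>_. count_space UNIV) (U N) {1..N}" for N
    using assms(4) by (rule indep_vars_row)
  have rv: "U N i \<in> measurable M (count_space UNIV)" if "i \<in> {1..N}" for N i
    using indep[of N] that by (auto simp: indep_vars_def)
  have law: "distr M (count_space UNIV) (U N i) = measure_pmf ?G" if "i \<in> {1..N}" for N i
    using rv[OF that] assms(2,3,5) that by (intro distr_eq_measure_pmf_nat) auto
  have integral: "integrable M (\<lambda>\<omega>. g (U N i \<omega>)) \<longleftrightarrow> integrable ?G g"
    "expectation (\<lambda>\<omega>. g (U N i \<omega>)) = measure_pmf.expectation ?G g"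
    if "i \<in> {1..N}" for N i and g :: "nat \<Rightarrow> real"
    using rv[OF that] by (auto simp: law[OF that, symmetric] integrable_distr_eq integral_distr)
  have mean: "AE \<omega> in M. (\<lambda>N. (\<Sum>i = 1..N. real (U N i \<omega>)) / real N) \<longlonglongrightarrow> ?m"
  proof (rule strong_law_rows[where \<delta> = "- ln (1 - p)" and \<phi> = "\<lambda>t. p / (1 - (1 - p) * exp t)"])
    show "indep_vars (\<lambda>_. borel) (\<lambda>i \<omega>. real (U N i \<omega>)) {1..N}" for N
      by (rule indep_vars_compose2[OF indep]) simp
    show "- ln (1 - p) > 0" using assms(2,3) by simp
    show "integrable M (\<lambda>\<omega>. exp (t * real (U N i \<omega>)))"
      "expectation (\<lambda>\<omega>. exp (t * real (U N i \<omega>))) = p / (1 - (1 - p) * exp t)"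
      if "i \<in> {1..N}" "\<bar>t\<bar> < - ln (1 - p)" for N i t
      using integral[OF that(1), of "\<lambda>k. exp (t * real k)"] mgf_geometric_pmf[of p t] assms(2,3) that(2)
      by auto
    show "((\<lambda>t. p / (1 - (1 - p) * exp t)) has_real_derivative ?m) (at 0)"
      using assms(2) by (auto intro!: derivative_eq_intros simp: field_simps)
  qed
  have freq: "AE \<omega> in M. (\<lambda>N. (\<Sum>i = 1..N. indicator {k} (U N i \<omega>)) / real N) \<longlonglongrightarrow> pmf ?G k" for k
  proof (rule strong_law_rows[where \<delta> = 1 and \<phi> = "\<lambda>t. 1 + (exp t - 1) * pmf ?G k"])
    show "indep_vars (\<lambda>_. borel) (\<lambda>i \<omega>. indicator {k} (U N i \<omega>)) {1..N}" for N
      by (rule indep_vars_compose2[OF indep]) simp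
    \<comment> \<open>The moment generating function of a Bernoulli variable, from the fact that the exponential of
      \<open>t\<close> times an indicator is affine in the indicator.\<close>
    have eq: "exp (t * indicator {k} j) = 1 + (exp t - 1) * indicator {k} j" for t :: real and j
      by (simp add: indicator_def)
    have int: "integrable ?G (indicator {k} :: nat \<Rightarrow> real)"
      by (simp add: integrable_real_indicator less_top[symmetric])
    show "integrable M (\<lambda>\<omega>. exp (t * indicator {k} (U N i \<omega>)))"
      "expectation (\<lambda>\<omega>. exp (t * indicator {k} (U N i \<omega>))) = 1 + (exp t - 1) * pmf ?G k"
      if "i \<in> {1..N}" for N i and t :: real
      using integral[OF that, of "\<lambda>j. exp (t * indicator {k} j)"] int
      unfolding eq by (auto simp: measure_pmf_single Bochner_Integration.integral_add)
    show "((\<lambda>t. 1 + (exp t - 1) * pmf ?G k) has_real_derivative pmf ?G k) (at 0)"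
      by (auto intro!: derivative_eq_intros)
  qed simp
  then have "AE \<omega> in M. \<forall>k. (\<lambda>N. (\<Sum>i = 1..N. indicator {k} (U N i \<omega>)) / real N) \<longlonglongrightarrow> pmf ?G k"
    by (simp add: AE_all_countable)
  with mean AE_space show ?thesis
  proof eventually_elim
    case (elim \<omega>)
    define S where "S N = (\<Sum>i = 1..N. U N i \<omega>)" for N
    have m: "?m > 0" using assms(2,3) by simp
    have mean: "(\<lambda>N. real (S N) / real N) \<longlonglongrightarrow> ?m"
      using elim(1) by (simp add: S_def)
    have "(\<lambda>N. ?m / (real (S N) / real N)) \<longlonglongrightarrow> ?m / ?m"
      using m by (intro tendsto_divide tendsto_const mean) auto
    then have scale: "(\<lambda>N. ?m / (real (S N) / real N)) \<longlonglongrightarrow> 1"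
      using m by (simp only: divide_self[OF less_imp_neq[OF m, symmetric]])
    \<comment> \<open>Row averages near \<open>?m > 0\<close> have nonzero row sum, which excludes the arbitrary values of \<open>X\<close>.\<close>
    have "\<forall>\<^sub>F N in sequentially. \<forall>i\<in>{1..N}. X N i \<omega> = ?m / (real (S N) / real N) * real (U N i \<omega>)"
      using order_tendstoD(1)[OF mean m]
    proof eventually_elim
      case (elim N)
      then have "S N \<noteq> 0" by (auto intro: gr0I)
      then show ?case
        using assms(6)[OF \<open>\<omega> \<in> space M\<close>, of _ N] by (auto simp: S_def)
    qed
    with elim scale show ?case
      unfolding geom_law_def
      by (intro weak_conv_nonneg_rescaled_empirical_measure[where u = "\<lambda>N i. U N i \<omega>"]) auto
  qed
qed

end
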